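(* Suppose that for every $w\in(0,\infty)$ the restriction of $\phi$ to $[0,1/w]$ is strongly convex. Then, for every $t\in[0,1]^m$ with $t\neq 0_{\mathbb{R}^m}$, the function $s\mapsto D_\phi(s\mid t)$ is strongly convex on $[0,1]^m_{\mathrm{supp}(t)}$.
   Context: Fix a positive integer $m$. The function $\phi:[0,\infty)\to\mathbb{R}$ is convex and continuous at $0$. Define $f:[0,\infty)^2\to\mathbb{R}\cup\{\infty\}$ by $f(v,w)=w\,\phi(v/w)$ if $v\ge 0$, $w>0$; $f(v,0)=v\lim_{x\to\infty}\phi(x)/x$ if $v>0$ (the limit exists in $\mathbb{R}\cup\{\infty\}$); and $f(0,0)=0$. For $s,t\in[0,\infty)^m$, the $\phi$-divergence of $s$ relative to $t$ is $D_\phi(s\mid t)=\sum_{i=1}^m f(s_i,t_i)$. For $s\in[0,\infty)^m$, $\mathrm{supp}(s)=\{i\in\{1,\dots,m\}:s_i>0\}$, and $[0,1]^m_{\mathrm{supp}(t)}=\{s\in[0,1]^m:\mathrm{supp}(s)\subset\mathrm{supp}(t)\}$. A function $H$ from a convex set $\mathcal{Y}\subset\mathbb{R}^d$ to $\mathbb{R}$ is strongly convex if there is a constant $\kappa_H\in(0,\infty)$ such that for all $x,y\in\mathcal{Y}$ and $\alpha\in[0,1]$, $H(\alpha x+(1-\alpha)y)\le \alpha H(x)+(1-\alpha)H(y)-\frac{\kappa_H}{2}\alpha(1-\alpha)\|x-y\|_2^2$. (In the hypothesis on $\phi$ the constant may depend on $w$.) *)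

theory Defs
  imports "HOL-Analysis.Analysis"
begin

text \<open>As with \<^const>\<open>convex_on\<close>, convexity of the domain is part of the definition. The library
  norm on a Euclidean space is the 2-norm.\<close>

definition strongly_convex_on :: "'a::euclidean_space set \<Rightarrow> ('a \<Rightarrow> real) \<Rightarrow> bool" where
  "strongly_convex_on Y H \<longleftrightarrow> convex Y \<and>
     (\<exists>\<kappa>>0. \<forall>x\<in>Y. \<forall>y\<in>Y. \<forall>\<alpha>\<in>{0..1}.
        H (\<alpha> *\<^sub>R x + (1 - \<alpha>) *\<^sub>R y)
          \<le> \<alpha> * H x + (1 - \<alpha>) * H y - \<kappa> / 2 * \<alpha> * (1 - \<alpha>) * (norm (x - y))\<^sup>2)"

text \<open>The arguments are meant to be nonnegative, and only the values of \<open>\<phi>\<close> on \<open>{0..}\<close>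
  are then used. The limit is taken in the extended reals, where it exists
  for \<open>\<phi>\<close> convex on \<open>{0..}\<close>.\<close>

definition phi_persp :: "(real \<Rightarrow> real) \<Rightarrow> real \<Rightarrow> real \<Rightarrow> ereal" where
  "phi_persp \<phi> v w =
     (if w > 0 then ereal (w * \<phi> (v / w))
      else if v > 0 then ereal v * Lim at_top (\<lambda>x. ereal (\<phi> x / x))
      else 0)"

definition phi_divergence :: "(real \<Rightarrow> real) \<Rightarrow> real^'m \<Rightarrow> real^'m \<Rightarrow> ereal" where
  "phi_divergence \<phi> s t = (\<Sum>i\<in>UNIV. phi_persp \<phi> (s $ i) (t $ i))"

definition vec_supp :: "real^'m \<Rightarrow> 'm set" where
  "vec_supp s = {i. s $ i > 0}"

definition unit_cube_supp :: "real^'m \<Rightarrow> (real^'m) set" where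
  "unit_cube_supp t = {s. (\<forall>i. s $ i \<in> {0..1}) \<and> vec_supp s \<subseteq> vec_supp t}"

end

theory Submission
  imports Defs
begin

text \<open>On the given domain the divergence is a separable sum over a box. A coordinate with
  \<open>t $ i > 0\<close> ranges over \<open>{0..1}\<close> and contributes
  \<open>t $ i * \<phi> (v / t $ i)\<close>, a rescaling of \<phi> restricted to
  \<open>{0..1 / t $ i}\<close>, hence strongly convex
  (\<open>strongly_convex_on_perspective\<close>). Any other coordinate is frozen at 0 and
  contributes 0; on a single point every function is strongly convex, since the quadratic term
  vanishes. As the squared 2-norm is the sum of the squared coordinates, the one-dimensional
  inequalities add up (\<open>strongly_convex_on_separable_sum\<close>), with the smallest of the
  finitely many constants.\<close>

lemma strongly_convex_on_singleton: "strongly_convex_on {a} H"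
  unfolding strongly_convex_on_def
  by (auto intro!: exI[of _ 1] simp: algebra_simps simp flip: scaleR_add_left)

text \<open>Dividing the argument by \<open>w\<close> scales squared distances by 1/w^2, and the
  outer factor \<open>w\<close> restores one power, so a constant \<kappa> for \<phi> becomes
  \<kappa>/w.\<close>

lemma strongly_convex_on_perspective:
  fixes \<phi> :: "real \<Rightarrow> real"
  assumes w: "w > 0" and \<phi>: "strongly_convex_on {0..c / w} \<phi>"
  shows "strongly_convex_on {0..c} (\<lambda>v. w * \<phi> (v / w))"
proof -
  obtain \<kappa> where \<kappa>: "\<kappa> > 0"
    "\<And>x y \<alpha>. \<lbrakk>x \<in> {0..c / w}; y \<in> {0..c / w}; \<alpha> \<in> {0..1}\<rbrakk> \<Longrightarrow>
       \<phi> (\<alpha> *\<^sub>R x + (1 - \<alpha>) *\<^sub>R y)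
         \<le> \<alpha> * \<phi> x + (1 - \<alpha>) * \<phi> y - \<kappa> / 2 * \<alpha> * (1 - \<alpha>) * (norm (x - y))\<^sup>2"
    using \<phi> unfolding strongly_convex_on_def by blast
  have "w * \<phi> ((\<alpha> *\<^sub>R x + (1 - \<alpha>) *\<^sub>R y) / w)
      \<le> \<alpha> * (w * \<phi> (x / w)) + (1 - \<alpha>) * (w * \<phi> (y / w))
        - \<kappa> / w / 2 * \<alpha> * (1 - \<alpha>) * (norm (x - y))\<^sup>2"
    if "x \<in> {0..c}" "y \<in> {0..c}" "\<alpha> \<in> {0..1}" for x y \<alpha>
  proof -
    have "\<phi> (\<alpha> *\<^sub>R (x / w) + (1 - \<alpha>) *\<^sub>R (y / w))
      \<le> \<alpha> * \<phi> (x / w) + (1 - \<alpha>) * \<phi> (y / w)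
        - \<kappa> / 2 * \<alpha> * (1 - \<alpha>) * (norm (x / w - y / w))\<^sup>2"
      using that w by (intro \<kappa>(2)) (auto simp: divide_right_mono)
    also have "\<alpha> *\<^sub>R (x / w) + (1 - \<alpha>) *\<^sub>R (y / w) = (\<alpha> *\<^sub>R x + (1 - \<alpha>) *\<^sub>R y) / w"
      by (simp add: add_divide_distrib)
    also have "(norm (x / w - y / w))\<^sup>2 = (norm (x - y))\<^sup>2 / w\<^sup>2"
      by (simp add: power_divide flip: diff_divide_distrib)
    finally have "w * \<phi> ((\<alpha> *\<^sub>R x + (1 - \<alpha>) *\<^sub>R y) / w)
      \<le> w * (\<alpha> * \<phi> (x / w) + (1 - \<alpha>) * \<phi> (y / w)
        - \<kappa> / 2 * \<alpha> * (1 - \<alpha>) * ((norm (x - y))\<^sup>2 / w\<^sup>2))"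
      using w by (intro mult_left_mono) auto
    also have "\<dots> = \<alpha> * (w * \<phi> (x / w)) + (1 - \<alpha>) * (w * \<phi> (y / w))
        - \<kappa> / w / 2 * \<alpha> * (1 - \<alpha>) * (norm (x - y))\<^sup>2"
      using w by (simp add: power2_eq_square[of w] field_simps)
    finally show ?thesis .
  qed
  with \<kappa>(1) w show ?thesis
    unfolding strongly_convex_on_def by (auto intro!: exI[of _ "\<kappa> / w"] simp: convex_closed_interval)
qed

lemma strongly_convex_on_separable_sum:
  fixes Y :: "'m::finite \<Rightarrow> real set" and g :: "'m \<Rightarrow> real \<Rightarrow> real"
  assumes g: "\<And>i. strongly_convex_on (Y i) (g i)"
  shows "strongly_convex_on {s :: real^'m. \<forall>i. s $ i \<in> Y i} (\<lambda>s. \<Sum>i\<in>UNIV. g i (s $ i))"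
proof -
  have "\<forall>i. \<exists>\<kappa>>0. \<forall>x\<in>Y i. \<forall>y\<in>Y i. \<forall>\<alpha>\<in>{0..1}.
      g i (\<alpha> *\<^sub>R x + (1 - \<alpha>) *\<^sub>R y)
        \<le> \<alpha> * g i x + (1 - \<alpha>) * g i y - \<kappa> / 2 * \<alpha> * (1 - \<alpha>) * (norm (x - y))\<^sup>2"
    using g unfolding strongly_convex_on_def by blast
  then obtain \<kappa> where pos: "\<And>i. \<kappa> i > 0"
    and \<kappa>: "\<And>i x y \<alpha>. \<lbrakk>x \<in> Y i; y \<in> Y i; \<alpha> \<in> {0..1}\<rbrakk> \<Longrightarrow>
      g i (\<alpha> *\<^sub>R x + (1 - \<alpha>) *\<^sub>R y)
        \<le> \<alpha> * g i x + (1 - \<alpha>) * g i y - \<kappa> i / 2 * \<alpha> * (1 - \<alpha>) * (norm (x - y))\<^sup>2"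
    by metis
  \<comment> \<open>The index type is finite, so the minimum is attained and stays positive.\<close>
  define k where "k = Min (range \<kappa>)"
  have k: "k > 0" "\<And>i. k \<le> \<kappa> i"
    using pos by (simp_all add: k_def)
  have "(\<Sum>i\<in>UNIV. g i ((\<alpha> *\<^sub>R x + (1 - \<alpha>) *\<^sub>R y) $ i))
      \<le> \<alpha> * (\<Sum>i\<in>UNIV. g i (x $ i)) + (1 - \<alpha>) * (\<Sum>i\<in>UNIV. g i (y $ i))
        - k / 2 * \<alpha> * (1 - \<alpha>) * (norm (x - y))\<^sup>2"
    if x: "\<And>i. x $ i \<in> Y i" and y: "\<And>i. y $ i \<in> Y i" and \<alpha>: "\<alpha> \<in> {0..1}" for x y :: "real^'m" and \<alpha>
  proof -
    have "(\<Sum>i\<in>UNIV. g i ((\<alpha> *\<^sub>R x + (1 - \<alpha>) *\<^sub>R y) $ i))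
        \<le> (\<Sum>i\<in>UNIV. \<alpha> * g i (x $ i) + (1 - \<alpha>) * g i (y $ i)
             - k / 2 * \<alpha> * (1 - \<alpha>) * ((x - y) $ i)\<^sup>2)"
    proof (rule sum_mono)
      fix i
      \<comment> \<open>Lowering the constant only weakens the inequality, because \<alpha>, 1 -
        \<alpha> and the square are nonnegative.\<close>
      have "k / 2 * \<alpha> * (1 - \<alpha>) * ((x - y) $ i)\<^sup>2 \<le> \<kappa> i / 2 * \<alpha> * (1 - \<alpha>) * ((x - y) $ i)\<^sup>2"
        using k(2)[of i] \<alpha> by (intro mult_right_mono) auto
      with \<kappa>[OF x y \<alpha>, of i]
      show "g i ((\<alpha> *\<^sub>R x + (1 - \<alpha>) *\<^sub>R y) $ i) \<le> \<alpha> * g i (x $ i) + (1 - \<alpha>) * g i (y $ i)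
             - k / 2 * \<alpha> * (1 - \<alpha>) * ((x - y) $ i)\<^sup>2"
        by simp
    qed
    also have "\<dots> = \<alpha> * (\<Sum>i\<in>UNIV. g i (x $ i)) + (1 - \<alpha>) * (\<Sum>i\<in>UNIV. g i (y $ i))
        - k / 2 * \<alpha> * (1 - \<alpha>) * (\<Sum>i\<in>UNIV. ((x - y) $ i)\<^sup>2)"
      by (simp only: sum.distrib sum_subtractf sum_distrib_left)
    also have "(\<Sum>i\<in>UNIV. ((x - y) $ i)\<^sup>2) = (norm (x - y))\<^sup>2"
      unfolding power2_norm_eq_inner inner_vec_def by (simp add: power2_eq_square)
    finally show ?thesis .
  qed
  moreover have "convex {s :: real^'m. \<forall>i. s $ i \<in> Y i}"
    using g unfolding strongly_convex_on_def by (intro convex_box_cart) (simp add: Collect_mem_eq)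
  ultimately show ?thesis
    using k(1) unfolding strongly_convex_on_def by blast
qed

text \<open>Off the support of \<open>t\<close> a coordinate in \<open>{0..1}\<close> must not be
  positive, so it is 0. This product form is what the separable-sum lemma needs.\<close>

lemma unit_cube_supp_eq_box:
  fixes t :: "real^'m"
  shows "unit_cube_supp t = {s. \<forall>i. s $ i \<in> (if t $ i > 0 then {0..1} else {0})}"
proof -
  have "s $ i \<in> {0..1} \<and> (s $ i > 0 \<longrightarrow> t $ i > 0)
      \<longleftrightarrow> s $ i \<in> (if t $ i > 0 then {0..1} else {0})" for s :: "real^'m" and i
    by auto
  then show ?thesis
    unfolding unit_cube_supp_def vec_supp_def subset_iff mem_Collect_eq all_conj_distrib[symmetric]
    by simp
qed

text \<open>The limit branch of \<open>phi_persp\<close> requires \<open>s $ i > 0\<close> where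
  \<open>t $ i\<close> is not positive, which the support condition excludes. Only real summands
  remain.\<close>

lemma phi_divergence_eq_sum:
  assumes "s \<in> unit_cube_supp t"
  shows "phi_divergence \<phi> s t
    = ereal (\<Sum>i\<in>UNIV. if t $ i > 0 then t $ i * \<phi> (s $ i / t $ i) else 0)"
proof -
  have "s $ i = 0" if "\<not> t $ i > 0" for i
    using assms that unfolding unit_cube_supp_eq_box by (auto dest: spec[of _ i])
  then show ?thesis
    unfolding phi_divergence_def phi_persp_def sum_ereal[symmetric]
    by (intro sum.cong) auto
qed

text \<open>The inequality also evaluates the function at a convex combination; convexity of
  \<open>Y\<close> keeps that point where \<open>H\<close> and \<open>G\<close> agree.\<close>

lemma strongly_convex_on_cong:
  assumes "strongly_convex_on Y G" and eq: "\<And>x. x \<in> Y \<Longrightarrow> H x = G x"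
  shows "strongly_convex_on Y H"
proof -
  have "\<alpha> *\<^sub>R x + (1 - \<alpha>) *\<^sub>R y \<in> Y" if "x \<in> Y" "y \<in> Y" "\<alpha> \<in> {0..1}" for x y \<alpha>
    using assms(1) that unfolding strongly_convex_on_def by (auto intro: convexD)
  with assms show ?thesis
    unfolding strongly_convex_on_def by metis
qed

theorem proposition10:
  fixes \<phi> :: "real \<Rightarrow> real" and t :: "real^'m"
  assumes "convex_on {0..} \<phi>"
    and "continuous (at 0 within {0..}) \<phi>"
    and "\<And>w. w > 0 \<Longrightarrow> strongly_convex_on {0..1 / w} \<phi>"
    and "\<And>i. t $ i \<in> {0..1}"
    and "t \<noteq> 0"
  shows "(\<forall>s\<in>unit_cube_supp t. \<bar>phi_divergence \<phi> s t\<bar> \<noteq> \<infinity>) \<and>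
         strongly_convex_on (unit_cube_supp t) (\<lambda>s. real_of_ereal (phi_divergence \<phi> s t))"
proof
  \<comment> \<open>Since \<open>real_of_ereal\<close> sends infinite values to 0, finiteness is
    what makes the second conjunct speak of the divergence itself.\<close>
  show "\<forall>s\<in>unit_cube_supp t. \<bar>phi_divergence \<phi> s t\<bar> \<noteq> \<infinity>"
    by (simp add: phi_divergence_eq_sum)
  have "strongly_convex_on (if t $ i > 0 then {0..1} else {0})
      (\<lambda>v. if t $ i > 0 then t $ i * \<phi> (v / t $ i) else 0)" for i
    \<comment> \<open>The hypothesis on \<phi> is taken at \<open>w = t $ i\<close>, so its constant
      varies with the coordinate.\<close>
    using strongly_convex_on_perspective[of "t $ i" 1 \<phi>] assms(3)[of "t $ i"]
    by (simp add: strongly_convex_on_singleton)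
  then have "strongly_convex_on (unit_cube_supp t)
      (\<lambda>s. \<Sum>i\<in>UNIV. if t $ i > 0 then t $ i * \<phi> (s $ i / t $ i) else 0)"
    unfolding unit_cube_supp_eq_box by (rule strongly_convex_on_separable_sum)
  then show "strongly_convex_on (unit_cube_supp t) (\<lambda>s. real_of_ereal (phi_divergence \<phi> s t))"
    by (rule strongly_convex_on_cong) (simp add: phi_divergence_eq_sum)
qed

end
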